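(* For every odd integer $k\ge 3$ and every integer $n\ge 7k-4$, $r(C_n,C_k)=2n-1$.
   Context: For graphs $H_1,H_2$, the Ramsey number $r(H_1,H_2)$ is the smallest positive integer $N$ such that every (finite simple) graph $\Gamma$ on $N$ vertices contains $H_1$ as a (not necessarily induced) subgraph or its complement $\overline{\Gamma}$ contains $H_2$ as a subgraph. $C_m$ is the cycle on $m$ vertices. *)

theory Defs
  imports "Graph_Theory.Graph_Theory"
begin

text \<open>
  Finite simple graphs are the \<open>pair_graph\<close>s of \<open>Graph_Theory\<close>: finite, loop-free, symmetric
  digraphs whose arcs are pairs of vertices, so that an edge \<open>uv\<close> is the pair of arcs
  \<open>(u, v)\<close>, \<open>(v, u)\<close>.
\<close>

definition complement_graph :: "'a pair_pre_digraph \<Rightarrow> 'a pair_pre_digraph" where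
  "complement_graph G =
     \<lparr> pverts = pverts G,
       parcs = {(u, v). u \<in> pverts G \<and> v \<in> pverts G \<and> u \<noteq> v \<and> (u, v) \<notin> parcs G} \<rparr>"

text \<open>
  The subgraph need not be induced: \<open>subgraph\<close> only asks for inclusion of vertices and arcs.
  \<open>K\<close> is symmetric whenever \<open>H\<close> is, being isomorphic to it.
\<close>

definition contains_copy :: "'a pair_pre_digraph \<Rightarrow> 'b pair_pre_digraph \<Rightarrow> bool" where
  "contains_copy G H \<longleftrightarrow>
     (\<exists>K :: 'a pair_pre_digraph.
        subgraph (with_proj K) (with_proj G) \<and> digraph_iso (with_proj H) (with_proj K))"

text \<open>
  For \<open>m \<ge> 3\<close> this is the cycle on \<open>m\<close> vertices; for smaller \<open>m\<close> it is not meaningful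
  (\<open>m = 1\<close> gives a loop, \<open>m = 2\<close> a single edge).
\<close>

definition cycle_graph :: "nat \<Rightarrow> nat pair_pre_digraph" where
  "cycle_graph m =
     \<lparr> pverts = {..<m},
       parcs = {(i, j). i < m \<and> j < m \<and> (j = Suc i mod m \<or> i = Suc j mod m)} \<rparr>"

text \<open>
  Every finite graph is isomorphic to one whose vertices are natural numbers, so it suffices to
  let \<open>G\<close> range over the latter. The least element is well-defined only because such an \<open>N\<close>
  exists, i.e. by Ramsey's theorem.
\<close>

definition ramsey_number :: "'a pair_pre_digraph \<Rightarrow> 'b pair_pre_digraph \<Rightarrow> nat" where
  "ramsey_number H1 H2 =
     (LEAST N. 0 < N \<and>
        (\<forall>G :: nat pair_pre_digraph. pair_graph G \<and> card (pverts G) = N \<longrightarrow>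
           contains_copy G H1 \<or> contains_copy (complement_graph G) H2))"

lemma pair_graph_complement_graph:
  assumes "pair_graph G"
  shows "pair_graph (complement_graph G)"
proof -
  interpret pair_graph G by fact
  have "finite (parcs (complement_graph G))"
    by (rule finite_subset[of _ "pverts G \<times> pverts G"]) (auto simp: complement_graph_def)
  moreover have "sym (parcs (complement_graph G))"
    using pair_sym_arcs by (auto simp: complement_graph_def symmetric_def sym_def)
  ultimately show ?thesis
    by unfold_locales (auto simp: complement_graph_def symmetric_def)
qed

lemma pair_graph_cycle_graph:
  assumes "m \<ge> 3"
  shows "pair_graph (cycle_graph m)"
proof -
  have neq: "Suc i mod m \<noteq> i" if "i < m" for i
    using that assms by (cases "Suc i = m") auto
  have "finite (parcs (cycle_graph m))"
    by (rule finite_subset[of _ "{..<m} \<times> {..<m}"]) (auto simp: cycle_graph_def)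
  moreover have "sym (parcs (cycle_graph m))"
    by (auto simp: cycle_graph_def sym_def)
  moreover have "fst e \<noteq> snd e" if "e \<in> parcs (cycle_graph m)" for e
    using that neq[of "fst e"] by (auto simp: cycle_graph_def)
  moreover have "fst e \<in> pverts (cycle_graph m)" "snd e \<in> pverts (cycle_graph m)"
    if "e \<in> parcs (cycle_graph m)" for e
    using that by (auto simp: cycle_graph_def)
  moreover have "finite (pverts (cycle_graph m))"
    by (simp add: cycle_graph_def)
  ultimately show ?thesis
    by unfold_locales (simp_all add: symmetric_def)
qed

lemma contains_copy_iff_embedding:
  assumes "pair_wf_digraph G" "pair_wf_digraph H"
  shows "contains_copy G H \<longleftrightarrow>
    (\<exists>f. inj_on f (pverts H) \<and> f ` pverts H \<subseteq> pverts G \<and>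
         (\<forall>u v. (u, v) \<in> parcs H \<longrightarrow> (f u, f v) \<in> parcs G))"
    (is "_ \<longleftrightarrow> ?R")
proof
  assume "contains_copy G H"
  then obtain K h where K: "subgraph (with_proj K) (with_proj G)"
    and h: "pre_digraph.digraph_isomorphism (with_proj H) h"
    and eq: "with_proj K = app_iso h (with_proj H)"
    unfolding contains_copy_def digraph_iso_def by blast
  have vK: "pverts K = iso_verts h ` pverts H" and aK: "parcs K = iso_arcs h ` parcs H"
    and tK: "iso_tail h = fst" and hK: "iso_head h = snd"
    using eq by (auto simp: with_proj_def app_iso_def)
  have "inj_on (iso_verts h) (pverts H)"
    using h by (simp add: pre_digraph.digraph_isomorphism_def)
  moreover have "iso_verts h ` pverts H \<subseteq> pverts G"
    using K vK by (auto simp: subgraph_def)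
  moreover have "(iso_verts h u, iso_verts h v) \<in> parcs G" if "(u, v) \<in> parcs H" for u v
  proof -
    have "iso_arcs h (u, v) = (iso_verts h u, iso_verts h v)"
      using h that tK hK
      by (auto simp: pre_digraph.digraph_isomorphism_def prod_eq_iff dest!: bspec)
    moreover have "iso_arcs h (u, v) \<in> parcs G"
      using that K aK by (auto simp: subgraph_def)
    ultimately show ?thesis by simp
  qed
  ultimately show ?R by blast
next
  assume ?R
  then obtain f where f: "inj_on f (pverts H)" "f ` pverts H \<subseteq> pverts G"
    "\<forall>u v. (u, v) \<in> parcs H \<longrightarrow> (f u, f v) \<in> parcs G" by (elim exE conjE)
  interpret H: pair_wf_digraph H by fact
  define K where "K = \<lparr> pverts = f ` pverts H, parcs = map_prod f f ` parcs H \<rparr>"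
  define h where "h = \<lparr> iso_verts = f, iso_arcs = map_prod f f, iso_head = snd, iso_tail = fst \<rparr>"
  have wfK: "pair_wf_digraph K"
    by unfold_locales (auto simp: K_def dest: H.wellformed')
  have sub: "subgraph (with_proj K) (with_proj G)"
    using f wfK assms(1)
    by (auto simp: subgraph_def compatible_def wf_digraph_wp_iff) (auto simp: K_def)
  have "inj_on (map_prod f f) (parcs H)"
    using map_prod_inj_on[OF f(1) f(1)]
    by (rule inj_on_subset) (auto dest: H.wellformed')
  then have "pre_digraph.digraph_isomorphism (with_proj H) h"
    using f(1) assms(2)
    by (auto simp: pre_digraph.digraph_isomorphism_def h_def wf_digraph_wp_iff)
  then have "digraph_iso (with_proj H) (with_proj K)"
    unfolding digraph_iso_def
    by (intro exI[of _ h]) (auto simp: app_iso_def h_def K_def with_proj_def)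
  with sub show "contains_copy G H"
    unfolding contains_copy_def by blast
qed

end

theory Submission
  imports Defs
begin

text \<open>
  Two disjoint red cliques on at most \<open>n - 1\<close> vertices each, with all edges between them blue, have no
  red \<open>C\<^sub>n\<close> and no odd blue cycle. Conversely, suppose that a colouring of \<open>2n - 1\<close> vertices has no blue
  \<open>C\<^sub>k\<close>. If all red cycles were shorter than \<open>3k\<close>, the red graph would be degenerate; peeling off
  \<open>3k\<close> vertices of low red degree leaves a set to which they send almost only blue edges, so that a
  blue edge among them would lie on a blue \<open>C\<^sub>k\<close>, and without one they form a red clique and carry a
  red cycle. So there is a red cycle of length at least \<open>3k\<close>. There is no blue \<open>K\<^sub>k\<close>, so a red chord
  among every second vertex of an initial stretch shortens a cycle by less than \<open>2k\<close>, and the length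
  can be brought into the interval from \<open>3k\<close> to \<open>n\<close>. If a cycle of length \<open>m < n\<close> cannot be
  extended by one vertex, then a vertex outside it forms a blue clique with the successors of its red
  neighbours on the cycle, hence has at most \<open>k - 2\<close> of them. The at least \<open>n\<close> outer vertices thus
  send almost only blue edges to the cycle, and as before they form a red clique.
\<close>

section \<open>Cycles and paths as lists of vertices\<close>

text \<open>Lists, unlike embeddings of \<open>cycle_graph\<close>, can be cut, reversed and
  spliced. For symmetric \<open>R\<close> a list of length two is just an edge; the lengths of
  interest are at least 3.\<close>

definition cycle_in :: "'a set \<Rightarrow> ('a \<Rightarrow> 'a \<Rightarrow> bool) \<Rightarrow> 'a list \<Rightarrow> bool" where
  "cycle_in V R xs \<longleftrightarrow>
     xs \<noteq> [] \<and> distinct xs \<and> set xs \<subseteq> V \<and> successively R xs \<and> R (last xs) (hd xs)"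

lemma cycle_in_append_commute:
  assumes "cycle_in V R (xs @ ys)"
  shows "cycle_in V R (ys @ xs)"
  using assms by (cases "xs = []"; cases "ys = []")
    (auto simp: cycle_in_def successively_append_iff)

lemma cycle_in_Cons:
  assumes "cycle_in V R xs" "x \<in> V" "x \<notin> set xs" "R (last xs) x" "R x (hd xs)"
  shows "cycle_in V R (x # xs)"
  using assms by (auto simp: cycle_in_def successively_Cons)

text \<open>The cycle edges \<open>last us\<close>-\<open>hd vs\<close> and
  \<open>last vs\<close>-\<open>hd us\<close> are dropped, \<open>us\<close> is run backwards, and
  the pieces are joined through \<open>x\<close> and the chord between the two heads.\<close>

lemma cycle_in_cross_insert:
  assumes "cycle_in V R (us @ vs)" "us \<noteq> []" "vs \<noteq> []" "x \<in> V" "x \<notin> set (us @ vs)"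
    and "symp R" "R x (last us)" "R x (last vs)" "R (hd us) (hd vs)"
  shows "cycle_in V R (x # rev us @ vs)"
proof -
  have "successively R us"
    using assms(1) by (simp add: cycle_in_def successively_append_iff)
  then have "successively R (rev us)"
    using \<open>symp R\<close> by (auto elim: successively_mono dest: sympD)
  then show ?thesis
    using assms
    by (auto simp del: successively_rev simp: cycle_in_def successively_append_iff
        successively_Cons hd_append hd_rev last_rev dest: sympD)
qed

lemma cycle_in_clique:
  assumes "pairwise R S" "S \<subseteq> V" "finite S" "m \<le> card S" "2 \<le> m"
  shows "\<exists>xs. cycle_in V R xs \<and> length xs = m"
proof -
  obtain T where T: "T \<subseteq> S" "card T = m" "finite T"
    using obtain_subset_with_card_n[OF assms(4)] by metis
  obtain xs where xs: "set xs = T" "distinct xs"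
    using finite_distinct_list[OF T(3)] by blast
  have len: "length xs = m"
    using xs T(2) distinct_card by metis
  have pw: "R (xs ! i) (xs ! j)" if "i < m" "j < m" "i \<noteq> j" for i j
    using assms(1) T(1) xs that len
    by (metis nth_eq_iff_index_eq nth_mem pairwiseD subsetD)
  have ne: "xs \<noteq> []"
    using len assms(5) by auto
  have "successively R xs"
    using pw len by (auto simp: successively_conv_nth)
  moreover have "R (last xs) (hd xs)"
    using pw[of "m - 1" 0] len assms(5) ne by (simp add: last_conv_nth hd_conv_nth)
  ultimately show ?thesis
    using ne len xs T(1) assms(2) by (auto simp: cycle_in_def)
qed

text \<open>Between consecutive entries of \<open>fs\<close> a new common neighbour from
  \<open>D\<close> is inserted. The induction also counts the vertices of \<open>D\<close> already
  spent, which shows that a fresh one is left.\<close>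

lemma zigzag_path:
  assumes "fs \<noteq> []" "distinct fs" "set fs \<subseteq> F" "F \<inter> D = {}" "finite D" "symp B"
    and common: "\<And>u v. u \<in> F \<Longrightarrow> v \<in> F \<Longrightarrow> length fs \<le> Suc (card {d \<in> D. B u d \<and> B v d})"
  shows "\<exists>xs. xs \<noteq> [] \<and> distinct xs \<and> successively B xs \<and> hd xs = hd fs \<and> last xs = last fs \<and>
    set xs \<subseteq> set fs \<union> D \<and> length xs = 2 * length fs - 1 \<and> card (set xs \<inter> D) = length fs - 1"
  using assms(1-3) common
proof (induction fs rule: list_nonempty_induct)
  case (single x)
  then have "x \<notin> D" using assms(4) by auto
  then show ?case by (intro exI[of _ "[x]"]) auto
next
  case (cons f fs)
  have "length fs \<le> Suc (card {d \<in> D. B u d \<and> B v d})" if "u \<in> F" "v \<in> F" for u v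
    using cons.prems(3)[OF that] by simp
  then obtain xs where xs: "xs \<noteq> []" "distinct xs" "successively B xs" "hd xs = hd fs"
    "last xs = last fs" "set xs \<subseteq> set fs \<union> D" "length xs = 2 * length fs - 1"
    "card (set xs \<inter> D) = length fs - 1"
    using cons.IH cons.prems by auto
  let ?C = "{d \<in> D. B f d \<and> B (hd fs) d}"
  have F: "f \<in> F" "hd fs \<in> F" "set fs \<subseteq> F" "f \<notin> set fs"
    using cons.prems cons.hyps by auto
  have "length fs \<le> card ?C"
    using cons.prems(3)[OF F(1,2)] by simp
  moreover have "0 < length fs" using cons.hyps by simp
  ultimately have "card (set xs \<inter> D) < card ?C"
    using xs(8) by linarith
  then obtain d where d: "d \<in> ?C" "d \<notin> set xs \<inter> D"
    by (metis (lifting) List.finite_set card_mono finite_Int leD subsetI)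
  have "distinct (f # d # xs)"
    using xs d F assms(4) by auto
  moreover have "successively B (f # d # xs)"
    using xs d \<open>symp B\<close> by (auto simp: successively_Cons dest: sympD)
  moreover have "set (f # d # xs) \<inter> D = insert d (set xs \<inter> D)"
    using d F assms(4) by auto
  then have "card (set (f # d # xs) \<inter> D) = length (f # fs) - 1"
    using d xs(8) \<open>0 < length fs\<close> by simp
  ultimately show ?case
    using xs d cons.hyps by (intro exI[of _ "f # d # xs"]) auto
qed

text \<open>On a longest path, all neighbours of the first vertex lie on the path, and the farthest
  of them closes a cycle.\<close>

lemma ex_cycle_in_min_degree:
  assumes "finite U" "U \<noteq> {}" "symp R" "irreflp R" "1 \<le> d"
    and deg: "\<And>v. v \<in> U \<Longrightarrow> d \<le> card {u \<in> U. R v u}"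
  shows "\<exists>xs. cycle_in U R xs \<and> d < length xs"
proof -
  define P where "P xs \<longleftrightarrow> xs \<noteq> [] \<and> distinct xs \<and> set xs \<subseteq> U \<and> successively R xs" for xs
  obtain u where "u \<in> U" using assms(2) by auto
  then have "P [u]" by (simp add: P_def)
  moreover have "length xs < Suc (card U)" if "P xs" for xs
    using that assms(1) by (metis P_def card_mono distinct_card less_Suc_eq_le)
  ultimately obtain xs where xs: "P xs" and max: "\<And>ys. P ys \<Longrightarrow> length ys \<le> length xs"
    using ex_has_greatest_nat[of P "[u]" length "Suc (card U)"] by (metis less_imp_le_nat)
  have ne: "xs \<noteq> []" and dist: "distinct xs" and sub: "set xs \<subseteq> U"
    using xs by (auto simp: P_def)
  let ?v = "hd xs"
  let ?J = "{j. j < length xs \<and> R ?v (xs ! j)}"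
  have "{u \<in> U. R ?v u} \<subseteq> (!) xs ` ?J"
  proof
    fix u assume u: "u \<in> {u \<in> U. R ?v u}"
    have "u \<in> set xs"
    proof (rule ccontr)
      assume "u \<notin> set xs"
      then have "P (u # xs)"
        using xs u \<open>symp R\<close> by (auto simp: P_def successively_Cons dest: sympD)
      then show False using max by fastforce
    qed
    then show "u \<in> (!) xs ` ?J"
      using u by (auto simp: in_set_conv_nth)
  qed
  then have "card {u \<in> U. R ?v u} \<le> card ?J"
    by (intro surj_card_le) auto
  then have dJ: "d \<le> card ?J"
    using deg[of ?v] ne sub by (meson hd_in_set le_trans subsetD)
  have fJ: "finite ?J" by simp
  have "?J \<noteq> {}" using dJ assms(5) by (metis card.empty not_one_le_zero order.trans)
  define j where "j = Max ?J"
  have j: "j \<in> ?J" unfolding j_def using fJ \<open>?J \<noteq> {}\<close> by (rule Max_in)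
  \<comment> \<open>The neighbours, at least \<open>d\<close> many, sit at positions 1 to
    \<open>j\<close>, so the segment up to position \<open>j\<close> has more than \<open>d\<close>
    vertices.\<close>
  have "0 \<notin> ?J"
    using \<open>irreflp R\<close> ne by (auto simp: irreflp_def hd_conv_nth)
  then have "?J \<subseteq> {1..j}"
    using Max_ge[OF fJ] unfolding j_def by (auto simp: Suc_le_eq intro!: gr0I)
  then have "d \<le> j"
    using dJ card_mono[of "{1..j}" ?J] by simp
  have "cycle_in U R (take (Suc j) xs)"
  proof -
    have "successively R (take (Suc j) xs @ drop (Suc j) xs)"
      using xs by (simp add: P_def)
    then have "successively R (take (Suc j) xs)"
      unfolding successively_append_iff by blast
    moreover have "last (take (Suc j) xs) = xs ! j"
      using j by (simp add: take_Suc_conv_app_nth)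
    moreover have "hd (take (Suc j) xs) = hd xs" by simp
    moreover have "R (xs ! j) (hd xs)"
      using j \<open>symp R\<close> by (auto dest: sympD)
    ultimately show ?thesis
      using ne dist sub by (auto simp: cycle_in_def dest: in_set_takeD)
  qed
  moreover have "length (take (Suc j) xs) = Suc j" using j by simp
  ultimately show ?thesis using \<open>d \<le> j\<close> by (metis le_imp_less_Suc)
qed

section \<open>Two-colourings without a blue cycle of odd length \<open>k\<close>\<close>

text \<open>\<open>R\<close> is the graph and \<open>B\<close> its complement. Complementarity
  enters through \<open>coloured\<close>: where one colour is absent, the other is present.\<close>

locale two_colouring =
  fixes V :: "'a set" and R B :: "'a \<Rightarrow> 'a \<Rightarrow> bool" and k :: nat
  assumes finite_V: "finite V"
    and sym_R: "symp R" and sym_B: "symp B" and irrefl_R: "irreflp R"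
    and coloured: "\<lbrakk>u \<in> V; v \<in> V; u \<noteq> v\<rbrakk> \<Longrightarrow> R u v \<or> B u v"
    and odd_k: "odd k" and k_ge_3: "3 \<le> k"
    and no_blue: "cycle_in V B xs \<Longrightarrow> length xs \<noteq> k"
begin

lemma blue_clique_less:
  assumes "S \<subseteq> V" "pairwise B S"
  shows "card S < k"
proof (rule ccontr)
  assume "\<not> card S < k"
  then show False
    using cycle_in_clique[OF assms(2,1) finite_subset[OF assms(1) finite_V], of k] no_blue k_ge_3
    by auto
qed

text \<open>
  A blue edge inside \<open>F\<close> would be closed to a blue \<open>C\<^sub>k\<close> by a path alternating between \<open>F\<close> and \<open>D\<close>,
  because two vertices of \<open>F\<close> have at least \<open>k div 2\<close> common blue neighbours in \<open>D\<close>.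
\<close>

lemma red_clique:
  assumes "F \<subseteq> V" "D \<subseteq> V" "F \<inter> D = {}" "k \<le> card F" "2 * r + k div 2 \<le> card D"
    and few: "\<And>v. v \<in> F \<Longrightarrow> card {d \<in> D. R v d} \<le> r"
  shows "pairwise R F"
proof (rule pairwiseI, rule ccontr)
  fix x y assume xy: "x \<in> F" "y \<in> F" "x \<noteq> y" "\<not> R x y"
  then have "B x y" using coloured assms(1) by blast
  define q where "q = k div 2"
  have kq: "k = 2 * q + 1" using odd_k by (simp add: q_def)
  then have "1 \<le> q" using k_ge_3 by simp
  have finD: "finite D" and finF: "finite F"
    using assms(1,2) finite_V finite_subset by auto
  \<comment> \<open>Each of \<open>u\<close> and \<open>v\<close> loses at most \<open>r\<close>
    vertices of \<open>D\<close> to red edges.\<close>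
  have common: "q \<le> card {d \<in> D. B u d \<and> B v d}" if "u \<in> F" "v \<in> F" for u v
  proof -
    let ?C = "{d \<in> D. B u d \<and> B v d}"
    have "D \<subseteq> {d \<in> D. R u d} \<union> {d \<in> D. R v d} \<union> ?C"
      using coloured assms(1-3) that by blast
    then have "card D \<le> card ({d \<in> D. R u d} \<union> {d \<in> D. R v d} \<union> ?C)"
      using finD by (intro card_mono) auto
    also have "\<dots> \<le> card {d \<in> D. R u d} + card {d \<in> D. R v d} + card ?C"
      by (meson add_le_mono1 card_Un_le le_trans)
    finally show ?thesis
      using few[OF that(1)] few[OF that(2)] assms(5) by (simp add: q_def)
  qed
  have "card {x, y} \<le> 2" by (simp add: card_insert_if)
  \<comment> \<open>The path is to have \<open>q + 1\<close> vertices in \<open>F\<close>, among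
    them its ends \<open>x\<close> and \<open>y\<close>, and \<open>q\<close> in \<open>D\<close>:
    together \<open>2 * q + 1 = k\<close>, closed by the blue edge.\<close>
  then have "q - 1 \<le> card (F - {x, y})"
    using assms(4) diff_card_le_card_Diff[of "{x, y}" F] kq by simp
  then obtain T where T: "T \<subseteq> F - {x, y}" "card T = q - 1" "finite T"
    using obtain_subset_with_card_n by metis
  then obtain ts where ts: "set ts = T" "distinct ts"
    using finite_distinct_list by blast
  have lts: "length ts = q - 1" using ts T distinct_card by metis
  define fs where "fs = x # ts @ [y]"
  have fs: "fs \<noteq> []" "distinct fs" "set fs \<subseteq> F" "length fs = Suc q"
    using ts T xy lts \<open>1 \<le> q\<close> by (auto simp: fs_def)
  obtain xs where xs: "xs \<noteq> []" "distinct xs" "successively B xs" "hd xs = hd fs"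
    "last xs = last fs" "set xs \<subseteq> set fs \<union> D" "length xs = 2 * length fs - 1"
    using zigzag_path[OF fs(1-3) assms(3) finD sym_B] fs(4) common by auto
  have "set xs \<subseteq> V"
    using xs(6) fs(3) assms(1,2) by blast
  then have "cycle_in V B xs"
    using xs(1-5) \<open>B x y\<close> sym_B by (auto simp: cycle_in_def fs_def dest: sympD)
  then show False
    using no_blue xs(7) fs(4) kq by simp
qed

text \<open>If \<open>x\<close> were red to a successor, it could be inserted in front of that
  successor; if two successors were joined in red, \<open>cycle_in_cross_insert\<close> would apply.
  So \<open>x\<close> and the successors form a blue clique.\<close>

lemma few_red_neighbours_off_cycle:
  assumes "cycle_in V R xs" "x \<in> V" "x \<notin> set xs"
    and no_ext: "\<And>ys. cycle_in V R ys \<Longrightarrow> length ys \<noteq> Suc (length xs)"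
  shows "card {y \<in> set xs. R x y} \<le> k - 2"
proof -
  define m where "m = length xs"
  define I where "I = {i. i < m \<and> R x (xs ! i)}"
  define s where "s i = xs ! (Suc i mod m)" for i
  have ne: "xs \<noteq> []" and dist: "distinct xs" and sub: "set xs \<subseteq> V"
    using assms(1) by (auto simp: cycle_in_def)
  have m0: "0 < m" using ne by (simp add: m_def)
  have s_eq: "s i = (if Suc i = m then xs ! 0 else xs ! Suc i)" if "i < m" for i
    using that by (auto simp: s_def)
  have inj_s: "inj_on s {..<m}"
  proof (rule inj_onI)
    fix i j assume ij: "i \<in> {..<m}" "j \<in> {..<m}" "s i = s j"
    then have "Suc i mod m = Suc j mod m"
      using dist m0 by (simp add: s_def m_def nth_eq_iff_index_eq)
    then show "i = j"
      using ij by (auto simp: mod_Suc split: if_splits)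
  qed
  have s_in: "s i \<in> set xs" for i
    using m0 by (simp add: s_def m_def)
  \<comment> \<open>The cycle is rotated to start just after position \<open>i\<close>.\<close>
  have split1: "\<exists>us. cycle_in V R us \<and> set us = set xs \<and> length us = m \<and>
      last us = xs ! i \<and> hd us = s i" if "i < m" for i
  proof -
    let ?us = "drop (Suc i) xs @ take (Suc i) xs"
    have "cycle_in V R ?us"
      using cycle_in_append_commute[of V R "take (Suc i) xs" "drop (Suc i) xs"] assms(1) by simp
    moreover have "set ?us = set xs"
      by (metis append_take_drop_id set_append sup_commute)
    moreover have "last ?us = xs ! i"
      using that by (simp add: m_def take_Suc_conv_app_nth)
    moreover have "hd ?us = s i"
      using that s_eq[OF that] ne by (auto simp: m_def hd_append hd_drop_conv_nth hd_conv_nth)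
    ultimately show ?thesis using that by (intro exI[of _ ?us]) (auto simp: m_def)
  qed
  have xB: "\<not> R x (s i)" if "i \<in> I" for i
  proof
    assume *: "R x (s i)"
    have "i < m" using that by (simp add: I_def)
    then obtain us where us: "cycle_in V R us" "set us = set xs" "length us = m"
      "last us = xs ! i" "hd us = s i"
      using split1 by blast
    have "cycle_in V R (x # us)"
      using us assms(2,3) that * sym_R by (intro cycle_in_Cons) (auto simp: I_def dest: sympD)
    then show False using no_ext[of "x # us"] us(3) by (simp add: m_def)
  qed
  have sB: "\<not> R (s i) (s j)" if "i \<in> I" "j \<in> I" "i < j" for i j
  proof
    assume *: "R (s i) (s j)"
    have ij: "i < m" "j < m" using that by (auto simp: I_def)
    \<comment> \<open>The rotated cycle is cut into the stretch from \<open>s i\<close> to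
      \<open>xs ! j\<close> and the stretch from \<open>s j\<close> round to \<open>xs ! i\<close>;
      both ends are red neighbours of \<open>x\<close>, and the chord joins both starts.\<close>
    let ?us = "take (j - i) (drop (Suc i) xs)"
    let ?vs = "drop (Suc j) xs @ take (Suc i) xs"
    have dr: "?us @ drop (Suc j) xs = drop (Suc i) xs"
    proof -
      have "drop (Suc j) xs = drop (j - i) (drop (Suc i) xs)" using that by simp
      then show ?thesis by (simp only: append_take_drop_id)
    qed
    then have all: "?us @ ?vs = drop (Suc i) xs @ take (Suc i) xs"
      by (metis append_assoc)
    have cyc: "cycle_in V R (?us @ ?vs)"
      unfolding all using cycle_in_append_commute[of V R "take (Suc i) xs" "drop (Suc i) xs"] assms(1)
      by simp
    have set: "set (?us @ ?vs) = set xs"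
      unfolding all by (metis append_take_drop_id set_append sup_commute)
    have len: "length (?us @ ?vs) = m"
      unfolding all using ij by (simp add: m_def)
    have ne': "?us \<noteq> []" "?vs \<noteq> []"
      using ij that ne by (auto simp: m_def)
    have lu: "length ?us = j - i" using ij that by (simp add: m_def)
    have "last ?us = ?us ! (j - i - 1)"
      using ne'(1) lu by (metis last_conv_nth)
    also have "\<dots> = xs ! j" using ij that by (simp add: m_def)
    finally have last_us: "last ?us = xs ! j" .
    have hd_us: "hd ?us = s i"
      using ij that s_eq[OF ij(1)] by (simp add: m_def hd_drop_conv_nth)
    have last_vs: "last ?vs = xs ! i"
      using ij by (simp add: m_def take_Suc_conv_app_nth)
    have hd_vs: "hd ?vs = s j"
      using ij ne s_eq[OF ij(2)] by (auto simp: m_def hd_append hd_drop_conv_nth hd_conv_nth)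
    have "cycle_in V R (x # rev ?us @ ?vs)"
    proof (rule cycle_in_cross_insert[OF cyc ne' assms(2) _ sym_R])
      show "x \<notin> set (?us @ ?vs)" unfolding set by (rule assms(3))
      show "R x (last ?us)" "R x (last ?vs)" "R (hd ?us) (hd ?vs)"
        unfolding last_us last_vs hd_us hd_vs using that * by (auto simp: I_def)
    qed
    moreover have "length (x # rev ?us @ ?vs) = Suc m"
      using len by simp
    ultimately show False using no_ext unfolding m_def by blast
  qed
  have IB: "B (s i) (s j)" if "i \<in> I" "j \<in> I" "i \<noteq> j" for i j
  proof -
    have "s i \<noteq> s j" using inj_s that by (auto simp: inj_on_def I_def)
    moreover have "\<not> R (s i) (s j)"
      using sB that sym_R by (metis linorder_neqE_nat sympD)
    ultimately show ?thesis using coloured s_in sub by blast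
  qed
  have xIB: "B x (s i)" if "i \<in> I" for i
    using coloured[of x "s i"] xB[OF that] s_in[of i] sub assms(2,3) by auto
  have "pairwise B (insert x (s ` I))"
    using IB xIB sym_B by (auto simp: pairwise_def dest: sympD)
  moreover have "insert x (s ` I) \<subseteq> V"
    using assms(2) s_in sub by auto
  ultimately have "card (insert x (s ` I)) < k"
    using blue_clique_less by blast
  moreover have "finite I" by (simp add: I_def)
  moreover have "x \<notin> s ` I" using s_in assms(3) by auto
  moreover have "card (s ` I) = card I"
    using inj_s by (intro card_image) (auto simp: I_def inj_on_def)
  ultimately have "Suc (card I) < k" by simp
  moreover have "{y \<in> set xs. R x y} \<subseteq> (!) xs ` I"
    by (auto simp: I_def m_def in_set_conv_nth)
  then have "card {y \<in> set xs. R x y} \<le> card I"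
    using \<open>finite I\<close> by (meson card_image_le card_mono finite_imageI le_trans)
  ultimately show ?thesis by simp
qed

lemma ex_long_red_cycle:
  assumes "11 * k \<le> card V"
  shows "\<exists>xs. cycle_in V R xs \<and> 3 * k \<le> length xs"
proof (rule ccontr)
  assume none: "\<not> ?thesis"
  \<comment> \<open>Otherwise the minimum red degree in \<open>U\<close> would give a red cycle
    longer than \<open>3 * k\<close>.\<close>
  have low: "\<exists>v \<in> U. card {u \<in> U. R v u} \<le> 3 * k" if U: "U \<subseteq> V" "U \<noteq> {}" for U
  proof (rule ccontr)
    assume "\<not> ?thesis"
    then have "3 * k \<le> card {u \<in> U. R v u}" if "v \<in> U" for v
      using that by force
    then obtain xs where "cycle_in U R xs" "3 * k < length xs"
      using ex_cycle_in_min_degree[OF finite_subset[OF U(1) finite_V] U(2) sym_R irrefl_R,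
          of "3 * k"] k_ge_3
      by auto
    then have "cycle_in V R xs" "3 * k \<le> length xs"
      using U by (auto simp: cycle_in_def)
    then show False using none by blast
  qed
  \<comment> \<open>Only red neighbours outside \<open>F\<close> are counted, so the bound persists
    for the old vertices as \<open>F\<close> grows.\<close>
  have peel: "\<exists>F \<subseteq> V. card F = j \<and> (\<forall>v \<in> F. card {d \<in> V - F. R v d} \<le> 3 * k)"
    if "j \<le> card V" for j
    using that
  proof (induction j)
    case 0
    show ?case by (intro exI[of _ "{}"]) auto
  next
    case (Suc j)
    then obtain F where F: "F \<subseteq> V" "card F = j" "\<forall>v \<in> F. card {d \<in> V - F. R v d} \<le> 3 * k"
      by auto
    then have "V - F \<noteq> {}" using Suc.prems by auto
    then obtain v where v: "v \<in> V - F" "card {u \<in> V - F. R v u} \<le> 3 * k"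
      using low[of "V - F"] by auto
    have "card {d \<in> V - insert v F. R w d} \<le> 3 * k" if "w \<in> insert v F" for w
    proof -
      have "card {d \<in> V - insert v F. R w d} \<le> card {d \<in> V - F. R w d}"
        using finite_V by (intro card_mono) auto
      then show ?thesis using that v F by force
    qed
    then show ?case
      using F v finite_subset[OF F(1) finite_V] by (intro exI[of _ "insert v F"]) auto
  qed
  obtain F where F: "F \<subseteq> V" "card F = 3 * k" "\<forall>v \<in> F. card {d \<in> V - F. R v d} \<le> 3 * k"
    using peel[of "3 * k"] assms by auto
  have "card (V - F) = card V - 3 * k"
    using F finite_V by (simp add: card_Diff_subset finite_subset)
  \<comment> \<open>At least \<open>11 * k - 3 * k = 8 * k\<close> vertices remain, enough for
    \<open>red_clique\<close> with \<open>r = 3 * k\<close>.\<close>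
  then have "2 * (3 * k) + k div 2 \<le> card (V - F)" using assms by linarith
  then have "pairwise R F"
    using F by (intro red_clique[of F "V - F" "3 * k"]) auto
  then show False
    using cycle_in_clique[of R F V "3 * k"] F(1,2) finite_subset[OF F(1) finite_V] none k_ge_3
    by auto
qed

lemma shorten_red_cycle:
  assumes "cycle_in V R xs" "2 * k \<le> length xs"
  shows "\<exists>ys. cycle_in V R ys \<and> length ys < length xs \<and> length xs < length ys + 2 * k"
proof -
  have dist: "distinct xs" and sub: "set xs \<subseteq> V"
    using assms(1) by (auto simp: cycle_in_def)
  \<comment> \<open>The spacing by two ensures that a chord skips at least one vertex, so the new
    cycle is strictly shorter.\<close>
  let ?f = "\<lambda>a. xs ! (2 * a)"
  have inj: "inj_on ?f {..<k}"
    using dist assms(2) by (auto simp: inj_on_def nth_eq_iff_index_eq)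
  have subV: "?f ` {..<k} \<subseteq> V"
    using sub assms(2) by (auto intro!: subsetD[OF sub] nth_mem)
  have "\<not> pairwise B (?f ` {..<k})"
    using blue_clique_less[OF subV] card_image[OF inj] by auto
  then obtain a' b' where "a' < k" "b' < k" "?f a' \<noteq> ?f b'" "\<not> B (?f a') (?f b')"
    by (auto simp: pairwise_def)
  then have "R (?f a') (?f b')" "a' \<noteq> b'"
    using coloured subV by blast+
  then obtain a b where ab: "a < b" "b < k" "R (?f a) (?f b)"
    using \<open>a' < k\<close> \<open>b' < k\<close> sym_R by (metis linorder_neqE_nat sympD)
  \<comment> \<open>The \<open>2 * (b - a) - 1\<close> vertices strictly between the ends of the
    chord are cut out; this number is positive and below \<open>2 * k\<close>.\<close>
  let ?us = "take (Suc (2 * a)) xs" and ?vs = "drop (2 * b) xs"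
  have "successively R (?us @ drop (Suc (2 * a)) xs)" "successively R (take (2 * b) xs @ ?vs)"
    using assms(1) by (simp_all add: cycle_in_def)
  then have "successively R ?us" "successively R ?vs"
    unfolding successively_append_iff by blast+
  moreover have "last ?us = ?f a" "hd ?vs = ?f b"
    using ab assms(2) by (auto simp: take_Suc_conv_app_nth hd_drop_conv_nth)
  moreover have "distinct (?us @ ?vs)"
    using dist ab set_take_disj_set_drop_if_distinct[OF dist, of "Suc (2 * a)" "2 * b"] by simp
  moreover have "R (last xs) (hd xs)" using assms(1) by (simp add: cycle_in_def)
  moreover have "last ?vs = last xs" using ab assms(2) by simp
  moreover have "?us \<noteq> []" "?vs \<noteq> []" using ab assms(2) by auto
  moreover have "set (?us @ ?vs) \<subseteq> V"
    using sub by (auto dest: in_set_takeD in_set_dropD)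
  ultimately have "cycle_in V R (?us @ ?vs)"
    using ab by (simp add: cycle_in_def successively_append_iff)
  moreover have "length (?us @ ?vs) < length xs" "length xs < length (?us @ ?vs) + 2 * k"
    using ab assms(2) by auto
  ultimately show ?thesis by blast
qed

lemma extend_red_cycle:
  assumes "cycle_in V R xs" "3 * k \<le> length xs" "length xs < n" "2 * n - 1 \<le> card V"
  shows "(\<exists>ys. cycle_in V R ys \<and> length ys = Suc (length xs)) \<or>
    (\<exists>ys. cycle_in V R ys \<and> length ys = n)"
proof (rule ccontr)
  assume none: "\<not> ?thesis"
  let ?O = "V - set xs"
  have sub: "set xs \<subseteq> V" and card_xs: "card (set xs) = length xs"
    using assms(1) by (auto simp: cycle_in_def distinct_card)
  have card_O: "n \<le> card ?O"
    using sub card_xs assms(3,4) by (simp add: card_Diff_subset)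
  \<comment> \<open>The lower bound \<open>3 * k\<close> on the cycle length makes the cycle large
    enough to serve as \<open>D\<close> in \<open>red_clique\<close>.\<close>
  have "2 * (k - 2) + k div 2 \<le> card (set xs)"
    using card_xs assms(2) by linarith
  then have "pairwise R ?O"
    using few_red_neighbours_off_cycle[OF assms(1)] none sub card_O assms(2,3)
    by (intro red_clique[of ?O "set xs" "k - 2"]) auto
  then show False
    using cycle_in_clique[of R ?O V n] card_O finite_V none assms(2,3) k_ge_3 by auto
qed

lemma ex_red_cycle:
  assumes "7 * k - 4 \<le> n" "2 * n - 1 \<le> card V"
  shows "\<exists>xs. cycle_in V R xs \<and> length xs = n"
proof -
  \<comment> \<open>Indeed \<open>2 * (7 * k - 4) - 1 = 14 * k - 9\<close>, which is at least
    \<open>11 * k\<close> exactly when \<open>3 \<le> k\<close>.\<close>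
  have "11 * k \<le> card V" using assms k_ge_3 by linarith
  define P where "P m \<longleftrightarrow> 3 * k \<le> m \<and> (\<exists>xs. cycle_in V R xs \<and> length xs = m)" for m
  have "\<exists>m. P m"
    using ex_long_red_cycle[OF \<open>11 * k \<le> card V\<close>] by (auto simp: P_def)
  then have least: "P (LEAST m. P m)" by (rule LeastI_ex)
  \<comment> \<open>A cycle longer than \<open>n\<close> could be shortened by less than
    \<open>2 * k\<close>, staying above \<open>5 * k - 4\<close>, hence above \<open>3 * k\<close>,
    against minimality.\<close>
  have "(LEAST m. P m) \<le> n"
  proof (rule ccontr)
    assume gt: "\<not> ?thesis"
    obtain xs where xs: "cycle_in V R xs" "length xs = (LEAST m. P m)"
      using least by (auto simp: P_def)
    have "2 * k \<le> length xs"
      using gt xs(2) assms(1) k_ge_3 by linarith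
    then obtain ys where ys: "cycle_in V R ys" "length ys < length xs"
        "length xs < length ys + 2 * k"
      using shorten_red_cycle[OF xs(1)] by blast
    then have "P (length ys)"
      using gt xs(2) assms(1) k_ge_3 by (auto simp: P_def)
    then show False using ys(2) xs(2) not_less_Least by auto
  qed
  \<comment> \<open>The largest admissible length up to \<open>n\<close> cannot be raised by one, so
    it is \<open>n\<close> or \<open>extend_red_cycle\<close> yields \<open>n\<close>
    directly.\<close>
  then obtain m where m: "P m" "m \<le> n" and max: "\<And>j. P j \<Longrightarrow> j \<le> n \<Longrightarrow> j \<le> m"
    using ex_has_greatest_nat[of "\<lambda>m. P m \<and> m \<le> n" "LEAST m. P m" "\<lambda>m. m" "Suc n"] least
    by auto
  show ?thesis
  proof (cases "m = n")
    case True
    then show ?thesis using m by (auto simp: P_def)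
  next
    case False
    then obtain xs where xs: "cycle_in V R xs" "length xs = m" "3 * k \<le> m" "m < n"
      using m by (auto simp: P_def)
    have "\<not> P (Suc m)" using max[of "Suc m"] xs(4) by auto
    then show ?thesis
      using extend_red_cycle[of xs n] xs assms(2) by (auto simp: P_def)
  qed
qed

end

section \<open>From vertex lists to copies of cycle graphs\<close>

lemma contains_copy_cycle_graph_iff:
  assumes "pair_wf_digraph G" "3 \<le> m"
  shows "contains_copy G (cycle_graph m) \<longleftrightarrow>
    (\<exists>f. inj_on f {..<m} \<and> f ` {..<m} \<subseteq> pverts G \<and>
      (\<forall>i<m. (f i, f (Suc i mod m)) \<in> parcs G \<and> (f (Suc i mod m), f i) \<in> parcs G))"
proof -
  interpret H: pair_graph "cycle_graph m" by (rule pair_graph_cycle_graph[OF assms(2)])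
  have "pair_wf_digraph (cycle_graph m)" by unfold_locales
  from contains_copy_iff_embedding[OF assms(1) this] show ?thesis
    using assms(2) by (auto simp: cycle_graph_def)
qed

lemma contains_copy_cycle_graphI:
  assumes "pair_graph G" "3 \<le> m" "length xs = m"
    and cyc: "cycle_in (pverts G) (\<lambda>u v. (u, v) \<in> parcs G) xs"
  shows "contains_copy G (cycle_graph m)"
proof -
  interpret G: pair_graph G by fact
  have ne: "xs \<noteq> []" and dist: "distinct xs" and sub: "set xs \<subseteq> pverts G"
    and succ: "\<And>i. Suc i < m \<Longrightarrow> (xs ! i, xs ! Suc i) \<in> parcs G"
    and cl: "(last xs, hd xs) \<in> parcs G"
    using cyc assms(3) by (auto simp: cycle_in_def successively_conv_nth)
  have arc: "(xs ! i, xs ! (Suc i mod m)) \<in> parcs G" if "i < m" for i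
  proof (cases "Suc i = m")
    case True
    then show ?thesis
      using cl ne assms(3) by (auto simp: last_conv_nth hd_conv_nth)
  next
    case False
    then show ?thesis using succ that by simp
  qed
  have "(xs ! (Suc i mod m), xs ! i) \<in> parcs G" if "i < m" for i
    using arc[OF that] G.pair_sym_arcs by (auto simp: symmetric_def sym_def)
  moreover have "inj_on ((!) xs) {..<m}"
    using dist assms(3) by (auto simp: inj_on_def nth_eq_iff_index_eq)
  moreover have "(!) xs ` {..<m} \<subseteq> pverts G"
    using sub assms(3) by auto
  moreover have "pair_wf_digraph G" by unfold_locales
  ultimately show ?thesis
    using contains_copy_cycle_graph_iff[of G m] assms(2) arc by blast
qed

section \<open>The lower bound construction\<close>

text \<open>\<open>N\<close> is a parameter because minimality of the Ramsey number has to rule out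
  every smaller order, not just \<open>2 * n - 2\<close>.\<close>

definition two_cliques :: "nat \<Rightarrow> nat \<Rightarrow> nat pair_pre_digraph" where
  "two_cliques a N =
     \<lparr> pverts = {..<N}, parcs = {(u, v). u < N \<and> v < N \<and> u \<noteq> v \<and> (u < a \<longleftrightarrow> v < a)} \<rparr>"

lemma pair_graph_two_cliques: "pair_graph (two_cliques a N)"
proof -
  have "finite (parcs (two_cliques a N))"
    by (rule finite_subset[of _ "{..<N} \<times> {..<N}"]) (auto simp: two_cliques_def)
  moreover have "sym (parcs (two_cliques a N))"
    by (auto simp: two_cliques_def sym_def)
  ultimately show ?thesis
    by unfold_locales (auto simp: two_cliques_def symmetric_def)
qed

text \<open>A cycle stays within one clique, and each has at most \<open>n - 1\<close>
  vertices.\<close>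

lemma two_cliques_no_cycle:
  assumes "N \<le> 2 * n - 2" "3 \<le> n"
  shows "\<not> contains_copy (two_cliques (n - 1) N) (cycle_graph n)"
proof
  interpret G: pair_graph "two_cliques (n - 1) N" by (rule pair_graph_two_cliques)
  have wf: "pair_wf_digraph (two_cliques (n - 1) N)" by unfold_locales
  assume "contains_copy (two_cliques (n - 1) N) (cycle_graph n)"
  then obtain f where inj: "inj_on f {..<n}" and im: "f ` {..<n} \<subseteq> {..<N}"
    and arc: "\<And>i. i < n \<Longrightarrow> f i < n - 1 \<longleftrightarrow> f (Suc i mod n) < n - 1"
    using contains_copy_cycle_graph_iff[OF wf assms(2)] by (auto simp: two_cliques_def)
  have side: "f i < n - 1 \<longleftrightarrow> f 0 < n - 1" if "i < n" for i
    using that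
  proof (induction i)
    case (Suc i)
    then show ?case using arc[of i] by simp
  qed simp
  have "f ` {..<n} \<subseteq> {..<n - 1} \<or> f ` {..<n} \<subseteq> {n - 1..<N}"
  proof (cases "f 0 < n - 1")
    case True
    then show ?thesis using side by auto
  next
    case False
    then have "f i \<in> {n - 1..<N}" if "i < n" for i
      using side[OF that] im that by auto
    then show ?thesis by auto
  qed
  then have "card (f ` {..<n}) \<le> n - 1"
    using card_mono[of "{..<n - 1}" "f ` {..<n}"] card_mono[of "{n - 1..<N}" "f ` {..<n}"] assms(1)
    by auto
  then show False using card_image[OF inj] assms(2) by simp
qed

text \<open>The complement is bipartite.\<close>

lemma two_cliques_complement_no_odd_cycle:
  assumes "odd k" "3 \<le> k"
  shows "\<not> contains_copy (complement_graph (two_cliques a N)) (cycle_graph k)"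
proof
  interpret G: pair_graph "complement_graph (two_cliques a N)"
    by (rule pair_graph_complement_graph[OF pair_graph_two_cliques])
  have wf: "pair_wf_digraph (complement_graph (two_cliques a N))" by unfold_locales
  assume "contains_copy (complement_graph (two_cliques a N)) (cycle_graph k)"
  then obtain f where arc: "\<And>i. i < k \<Longrightarrow> f i < a \<longleftrightarrow> \<not> f (Suc i mod k) < a"
    using contains_copy_cycle_graph_iff[OF wf assms(2)]
    by (auto simp: two_cliques_def complement_graph_def)
  have side: "f i < a \<longleftrightarrow> (f 0 < a \<longleftrightarrow> even i)" if "i < k" for i
    using that
  proof (induction i)
    case (Suc i)
    then show ?case using arc[of i] by auto
  qed simp
  \<comment> \<open>As \<open>k - 1\<close> is even, the last vertex is on the side of the first,
    yet the closing edge changes sides.\<close>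
  show False
    using side[of "k - 1"] arc[of "k - 1"] assms by auto
qed

section \<open>Both bounds combined into the value of the Ramsey number\<close>

theorem corollary1p1:
  fixes k n :: nat
  assumes "odd k" and "k \<ge> 3" and "n \<ge> 7 * k - 4"
  shows "ramsey_number (cycle_graph n) (cycle_graph k) = 2 * n - 1"
  unfolding ramsey_number_def
proof (rule Least_equality)
  have n3: "3 \<le> n" using assms by linarith
  show "0 < 2 * n - 1 \<and> (\<forall>G :: nat pair_pre_digraph.
    pair_graph G \<and> card (pverts G) = 2 * n - 1 \<longrightarrow>
    contains_copy G (cycle_graph n) \<or> contains_copy (complement_graph G) (cycle_graph k))"
  proof (intro conjI allI impI disjCI; (elim conjE)?)
    show "0 < 2 * n - 1" using n3 by simp
  next
    fix G :: "nat pair_pre_digraph"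
    assume G: "pair_graph G" and card: "card (pverts G) = 2 * n - 1"
      and nb: "\<not> contains_copy (complement_graph G) (cycle_graph k)"
    interpret G: pair_graph G by fact
    note cG = pair_graph_complement_graph[OF G]
    interpret C: pair_graph "complement_graph G" by (rule cG)
    have pv: "pverts (complement_graph G) = pverts G"
      by (simp add: complement_graph_def)
    interpret two_colouring "pverts G" "\<lambda>u v. (u, v) \<in> parcs G"
      "\<lambda>u v. (u, v) \<in> parcs (complement_graph G)" k
    proof
      show "symp (\<lambda>u v. (u, v) \<in> parcs G)"
        using G.pair_sym_arcs by (auto simp: symmetric_def sym_def symp_def)
      show "symp (\<lambda>u v. (u, v) \<in> parcs (complement_graph G))"
        using C.pair_sym_arcs by (auto simp: symmetric_def sym_def symp_def)
      show "irreflp (\<lambda>u v. (u, v) \<in> parcs G)"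
        using G.pair_no_loops by (fastforce simp: irreflp_def)
      show "length xs \<noteq> k"
        if "cycle_in (pverts G) (\<lambda>u v. (u, v) \<in> parcs (complement_graph G)) xs" for xs
        using contains_copy_cycle_graphI[OF cG assms(2), of xs] nb that pv by auto
    qed (use assms in \<open>auto simp: complement_graph_def\<close>)
    show "contains_copy G (cycle_graph n)"
      using ex_red_cycle[OF assms(3)] card contains_copy_cycle_graphI[OF G n3] by auto
  qed
next
  fix N
  assume N: "0 < N \<and> (\<forall>G :: nat pair_pre_digraph.
    pair_graph G \<and> card (pverts G) = N \<longrightarrow>
    contains_copy G (cycle_graph n) \<or> contains_copy (complement_graph G) (cycle_graph k))"
  have n3: "3 \<le> n" using assms by linarith
  have "card (pverts (two_cliques (n - 1) N)) = N"
    by (simp add: two_cliques_def)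
  then have "contains_copy (two_cliques (n - 1) N) (cycle_graph n)"
    using N pair_graph_two_cliques two_cliques_complement_no_odd_cycle[OF assms(1,2)] by blast
  then have "\<not> N \<le> 2 * n - 2"
    using two_cliques_no_cycle n3 by blast
  then show "2 * n - 1 \<le> N" by linarith
qed

end
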